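(* Let $M$ be an EMV-algebra and let $\mathcal J(M)$ be the set of Jordan signed measures on $M$, with pointwise addition and the pointwise order $m_1\le^+ m_2$ iff $m_1(x)\le m_2(x)$ for all $x\in M$. Then: (a) $\mathcal J(M)$ is a Dedekind complete $\ell$-group with respect to $\le^+$. (b) If $\{m_i\}_{i\in I}$ is a non-empty subset of $\mathcal J(M)$ bounded above and $d(x)=\sup_i m_i(x)$ for $x\in M$, then $\bigvee_i m_i$ exists in $\mathcal J(M)$ and $(\bigvee_i m_i)(x)=\sup\{d(x_1)+\cdots+d(x_n): x=x_1+\cdots+x_n,\ n\ge1,\ x_1,\dots,x_n\in M\}$ for all $x\in M$. (c) If $\{m_i\}_{i\in I}$ is a non-empty subset of $\mathcal J(M)$ bounded below and $e(x)=\inf_i m_i(x)$, then $\bigwedge_i m_i$ exists and $(\bigwedge_i m_i)(x)=\inf\{e(x_1)+\cdots+e(x_n): x=x_1+\cdots+x_n,\ n\ge1,\ x_1,\dots,x_n\in M\}$ for all $x\in M$.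
   Context: An EMV-algebra is an algebra $(M;\vee,\wedge,\oplus,0)$ of type $\langle 2,2,2,0\rangle$ such that: (i) $(M;\oplus,0)$ is a commutative monoid with neutral element $0$; (ii) $(M;\vee,\wedge,0)$ is a distributive lattice with bottom $0$ (order $\le$); (iii) for each idempotent $a$ ($a\oplus a=a$; set $\mathcal I(M)$), $([0,a];\oplus,\lambda_a,0,a)$ is an MV-algebra, where $[0,a]=\{x:0\le x\le a\}$ and $\lambda_a(x)=\min\{z\in[0,a]:z\oplus x=a\}$; (iv) each element lies below some idempotent. For $x,y\le a\in\mathcal I(M)$, $x\odot y=\lambda_a(\lambda_a(x)\oplus\lambda_a(y))$ (independent of $a$). The partial operation $+$: $x+y$ is defined iff $x\odot y=0$, and then $x+y=x\oplus y$; "$x=x_1+\cdots+x_n$" means this iterated partial sum is defined and equals $x$. A signed measure is a map $m:M\to\mathbb R$ with $m(x+y)=m(x)+m(y)$ whenever $x+y$ is defined; a measure is a non-negative signed measure; a Jordan signed measure is a difference of two measures. *)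

theory Defs
  imports Complex_Main "HOL-Library.FuncSet" "HOL-Algebra.Group" "HOL-Algebra.Lattice"
begin

section \<open>MV-algebras\<close>

locale mv_algebra =
  fixes A :: "'a set"
    and add :: "'a \<Rightarrow> 'a \<Rightarrow> 'a"
    and neg :: "'a \<Rightarrow> 'a"
    and zero one :: 'a
  assumes add_monoid: "comm_monoid \<lparr>carrier = A, mult = add, one = zero\<rparr>"
    and neg_closed: "x \<in> A \<Longrightarrow> neg x \<in> A"
    and neg_zero: "neg zero = one"
    and neg_neg: "x \<in> A \<Longrightarrow> neg (neg x) = x"
    and add_one: "x \<in> A \<Longrightarrow> add x one = one"
    and lukasiewicz: "x \<in> A \<Longrightarrow> y \<in> A \<Longrightarrow>
          add (neg (add (neg x) y)) y = add (neg (add (neg y) x)) x"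


section \<open>EMV-algebras\<close>

record 'a emv = "'a partial_object" +
  vee :: "'a \<Rightarrow> 'a \<Rightarrow> 'a"  (infixl \<open>\<curlyvee>\<index>\<close> 65)
  wedge :: "'a \<Rightarrow> 'a \<Rightarrow> 'a"  (infixl \<open>\<curlywedge>\<index>\<close> 70)
  oplus :: "'a \<Rightarrow> 'a \<Rightarrow> 'a"  (infixl \<open>\<oplus>\<index>\<close> 65)
  emv_zero :: 'a  (\<open>\<zero>\<index>\<close>)

definition emv_le :: "('a, 'b) emv_scheme \<Rightarrow> 'a \<Rightarrow> 'a \<Rightarrow> bool"  (infix \<open>\<preceq>\<index>\<close> 50)
  where "x \<preceq>\<^bsub>M\<^esub> y \<longleftrightarrow> x \<curlywedge>\<^bsub>M\<^esub> y = x"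

definition idempotents :: "('a, 'b) emv_scheme \<Rightarrow> 'a set"
  where "idempotents M = {a \<in> carrier M. a \<oplus>\<^bsub>M\<^esub> a = a}"

definition below :: "('a, 'b) emv_scheme \<Rightarrow> 'a \<Rightarrow> 'a set"
  where "below M a = {x \<in> carrier M. \<zero>\<^bsub>M\<^esub> \<preceq>\<^bsub>M\<^esub> x \<and> x \<preceq>\<^bsub>M\<^esub> a}"

definition is_minimum :: "('a, 'b) emv_scheme \<Rightarrow> 'a \<Rightarrow> 'a set \<Rightarrow> bool"
  where "is_minimum M z Z \<longleftrightarrow> z \<in> Z \<and> (\<forall>w\<in>Z. z \<preceq>\<^bsub>M\<^esub> w)"

definition complements :: "('a, 'b) emv_scheme \<Rightarrow> 'a \<Rightarrow> 'a \<Rightarrow> 'a set"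
  where "complements M a x = {z \<in> below M a. z \<oplus>\<^bsub>M\<^esub> x = a}"

definition lam :: "('a, 'b) emv_scheme \<Rightarrow> 'a \<Rightarrow> 'a \<Rightarrow> 'a"
  where "lam M a x = (THE z. is_minimum M z (complements M a x))"

locale emv_algebra =
  fixes M :: "('a, 'b) emv_scheme" (structure)
  assumes oplus_monoid:
      "comm_monoid \<lparr>carrier = carrier M, mult = (\<oplus>), one = \<zero>\<rparr>"
    and vee_closed: "x \<in> carrier M \<Longrightarrow> y \<in> carrier M \<Longrightarrow> x \<curlyvee> y \<in> carrier M"
    and wedge_closed: "x \<in> carrier M \<Longrightarrow> y \<in> carrier M \<Longrightarrow> x \<curlywedge> y \<in> carrier M"
    and vee_assoc: "x \<in> carrier M \<Longrightarrow> y \<in> carrier M \<Longrightarrow> z \<in> carrier M \<Longrightarrow>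
          (x \<curlyvee> y) \<curlyvee> z = x \<curlyvee> (y \<curlyvee> z)"
    and wedge_assoc: "x \<in> carrier M \<Longrightarrow> y \<in> carrier M \<Longrightarrow> z \<in> carrier M \<Longrightarrow>
          (x \<curlywedge> y) \<curlywedge> z = x \<curlywedge> (y \<curlywedge> z)"
    and vee_comm: "x \<in> carrier M \<Longrightarrow> y \<in> carrier M \<Longrightarrow> x \<curlyvee> y = y \<curlyvee> x"
    and wedge_comm: "x \<in> carrier M \<Longrightarrow> y \<in> carrier M \<Longrightarrow> x \<curlywedge> y = y \<curlywedge> x"
    and vee_wedge_absorb: "x \<in> carrier M \<Longrightarrow> y \<in> carrier M \<Longrightarrow> x \<curlyvee> (x \<curlywedge> y) = x"
    and wedge_vee_absorb: "x \<in> carrier M \<Longrightarrow> y \<in> carrier M \<Longrightarrow> x \<curlywedge> (x \<curlyvee> y) = x"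
    and wedge_vee_distrib: "x \<in> carrier M \<Longrightarrow> y \<in> carrier M \<Longrightarrow> z \<in> carrier M \<Longrightarrow>
          x \<curlywedge> (y \<curlyvee> z) = (x \<curlywedge> y) \<curlyvee> (x \<curlywedge> z)"
    and zero_le: "x \<in> carrier M \<Longrightarrow> \<zero> \<preceq> x"
    \<comment> \<open>The existence of the minimum defining \<open>lam\<close> is part of the axiom that \<open>[0, a]\<close> is an
      MV-algebra; it has to be asked for separately because \<open>THE\<close> is total.\<close>
    and lam_exists: "a \<in> idempotents M \<Longrightarrow> x \<in> below M a \<Longrightarrow>
          \<exists>z. is_minimum M z (complements M a x)"
    and interval_mv: "a \<in> idempotents M \<Longrightarrow> mv_algebra (below M a) (\<oplus>) (lam M a) \<zero> a"
    and idempotent_above: "x \<in> carrier M \<Longrightarrow> \<exists>a \<in> idempotents M. x \<preceq> a"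

text \<open>The value does not depend on the idempotent above \<open>x\<close> and \<open>y\<close>, so any one may be chosen.\<close>

definition odot :: "('a, 'b) emv_scheme \<Rightarrow> 'a \<Rightarrow> 'a \<Rightarrow> 'a"  (infixl \<open>\<odot>\<index>\<close> 70)
  where "x \<odot>\<^bsub>M\<^esub> y =
    (let a = (SOME a. a \<in> idempotents M \<and> x \<preceq>\<^bsub>M\<^esub> a \<and> y \<preceq>\<^bsub>M\<^esub> a)
     in lam M a (lam M a x \<oplus>\<^bsub>M\<^esub> lam M a y))"

text \<open>The partial addition is given by its domain; where it is defined it agrees with \<open>\<oplus>\<close>.\<close>

definition plus_defined :: "('a, 'b) emv_scheme \<Rightarrow> 'a \<Rightarrow> 'a \<Rightarrow> bool"
  where "plus_defined M x y \<longleftrightarrow> x \<in> carrier M \<and> y \<in> carrier M \<and> x \<odot>\<^bsub>M\<^esub> y = \<zero>\<^bsub>M\<^esub>"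

text \<open>\<open>is_partial_sum M [x\<^sub>1, \<dots>, x\<^sub>n] x\<close> says that \<open>x\<^sub>1 + \<dots> + x\<^sub>n\<close>, with \<open>n \<ge> 1\<close> and
  bracketed to the left, is defined and equals \<open>x\<close>.\<close>

inductive is_partial_sum :: "('a, 'b) emv_scheme \<Rightarrow> 'a list \<Rightarrow> 'a \<Rightarrow> bool"
  for M :: "('a, 'b) emv_scheme"
  where
    single: "x \<in> carrier M \<Longrightarrow> is_partial_sum M [x] x"
  | snoc: "is_partial_sum M xs y \<Longrightarrow> plus_defined M y z \<Longrightarrow>
      is_partial_sum M (xs @ [z]) (y \<oplus>\<^bsub>M\<^esub> z)"


section \<open>Measures\<close>

text \<open>Functions on \<open>M\<close> are taken to be extensional, so that they are determined by their values
  on the carrier.\<close>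

definition signed_measures :: "('a, 'b) emv_scheme \<Rightarrow> ('a \<Rightarrow> real) set"
  where "signed_measures M = {m \<in> carrier M \<rightarrow>\<^sub>E UNIV.
    \<forall>x y. plus_defined M x y \<longrightarrow> m (x \<oplus>\<^bsub>M\<^esub> y) = m x + m y}"

definition measures_on :: "('a, 'b) emv_scheme \<Rightarrow> ('a \<Rightarrow> real) set"
  where "measures_on M = {m \<in> signed_measures M. \<forall>x\<in>carrier M. 0 \<le> m x}"

definition jordan_measures :: "('a, 'b) emv_scheme \<Rightarrow> ('a \<Rightarrow> real) set"
  where "jordan_measures M =
    {m \<in> signed_measures M. \<exists>m1\<in>measures_on M. \<exists>m2\<in>measures_on M.
       \<forall>x\<in>carrier M. m x = m1 x - m2 x}"

definition jordan_group :: "('a, 'b) emv_scheme \<Rightarrow> ('a \<Rightarrow> real) monoid"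
  where "jordan_group M =
    \<lparr>carrier = jordan_measures M,
     mult = (\<lambda>m1 m2. \<lambda>x\<in>carrier M. m1 x + m2 x),
     one = (\<lambda>x\<in>carrier M. 0)\<rparr>"

definition jordan_order :: "('a, 'b) emv_scheme \<Rightarrow> ('a \<Rightarrow> real) gorder"
  where "jordan_order M =
    \<lparr>carrier = jordan_measures M,
     eq = (=),
     le = (\<lambda>m1 m2. \<forall>x\<in>carrier M. m1 x \<le> m2 x)\<rparr>"

definition decomposition_sums :: "('a, 'b) emv_scheme \<Rightarrow> ('a \<Rightarrow> real) \<Rightarrow> 'a \<Rightarrow> real set"
  where "decomposition_sums M f x = {sum_list (map f xs) |xs. is_partial_sum M xs x}"


section \<open>Lattice-ordered groups\<close>

text \<open>A group and a lattice on the same carrier; the order is preserved by all translations.\<close>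

locale l_group = G?: group G + L?: lattice L
  for G :: "('a, 'b) monoid_scheme" (structure)
    and L :: "('a, 'c) gorder_scheme" (structure) +
  assumes same_carrier: "carrier L = carrier G"
    and translation_mono:
      "x \<in> carrier G \<Longrightarrow> y \<in> carrier G \<Longrightarrow> a \<in> carrier G \<Longrightarrow> b \<in> carrier G \<Longrightarrow>
        x \<sqsubseteq>\<^bsub>L\<^esub> y \<Longrightarrow> a \<otimes>\<^bsub>G\<^esub> x \<otimes>\<^bsub>G\<^esub> b \<sqsubseteq>\<^bsub>L\<^esub> a \<otimes>\<^bsub>G\<^esub> y \<otimes>\<^bsub>G\<^esub> b"

locale dedekind_complete_l_group = l_group +
  assumes bounded_above_lub:
    "A \<subseteq> carrier L \<Longrightarrow> A \<noteq> {} \<Longrightarrow> Upper L A \<noteq> {} \<Longrightarrow> \<exists>s. is_lub L s A"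

end

theory Submission
  imports Defs
begin

text \<open>
  The function \<open>d\<close> is a pointwise supremum of additive functions, hence subadditive for the partial
  addition. Let \<open>s x\<close> be the supremum of the sums \<open>d x\<^sub>1 + \<dots> + d x\<^sub>n\<close> over all decompositions of \<open>x\<close>;
  it is finite because an additive upper bound of the family dominates every such sum.
  Concatenating decompositions makes \<open>s\<close> superadditive. By the Riesz refinement property every
  decomposition of \<open>x + y\<close> splits into one of \<open>x\<close> and one of \<open>y\<close>, and subadditivity of \<open>d\<close> then makes
  \<open>s\<close> subadditive. So \<open>s\<close> is a signed measure; it is Jordan because it differs from a member of the
  family by a measure. Infima follow by negation.
\<close>

section \<open>Orthogonality and refinement in MV-algebras\<close>

context mv_algebra
begin

text \<open>Truncated difference \<open>x \<odot> neg y\<close>; on the real unit interval it is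
  max(x - y, 0).\<close>

definition diff :: "'a \<Rightarrow> 'a \<Rightarrow> 'a"
  where "diff x y = neg (add (neg x) y)"

text \<open>The condition \<open>x \<odot> y = zero\<close> with the outer complement removed: the
  domain of the partial addition.\<close>

definition orth :: "'a \<Rightarrow> 'a \<Rightarrow> bool"
  where "orth x y \<longleftrightarrow> add (neg x) (neg y) = one"

section \<open>Sums and complements\<close>

lemma zero_closed [simp]: "zero \<in> A"
  using monoid.one_closed[OF comm_monoid.axioms(1)[OF add_monoid]] by simp

lemma add_closed [simp]: "x \<in> A \<Longrightarrow> y \<in> A \<Longrightarrow> add x y \<in> A"
  using monoid.m_closed[OF comm_monoid.axioms(1)[OF add_monoid]] by simp

lemma add_assoc: "x \<in> A \<Longrightarrow> y \<in> A \<Longrightarrow> z \<in> A \<Longrightarrow> add (add x y) z = add x (add y z)"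
  using monoid.m_assoc[OF comm_monoid.axioms(1)[OF add_monoid]] by simp

lemma add_comm: "x \<in> A \<Longrightarrow> y \<in> A \<Longrightarrow> add x y = add y x"
  using comm_monoid.m_comm[OF add_monoid] by simp

lemma add_left_comm: "x \<in> A \<Longrightarrow> y \<in> A \<Longrightarrow> z \<in> A \<Longrightarrow> add x (add y z) = add y (add x z)"
  by (metis add_assoc add_comm)

lemmas add_ac = add_assoc add_comm add_left_comm

lemma zero_add [simp]: "x \<in> A \<Longrightarrow> add zero x = x"
  using monoid.l_one[OF comm_monoid.axioms(1)[OF add_monoid]] by simp

lemma add_zero [simp]: "x \<in> A \<Longrightarrow> add x zero = x"
  by (simp add: add_comm[of x zero])

declare neg_closed [simp] neg_zero [simp] neg_neg [simp] add_one [simp]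

lemma one_closed [simp]: "one \<in> A"
  using neg_closed[OF zero_closed] by simp

lemma one_add [simp]: "x \<in> A \<Longrightarrow> add one x = one"
  by (simp add: add_comm[of one x])

lemma neg_one [simp]: "neg one = zero"
  using neg_neg[OF zero_closed] by simp

lemma neg_eq_zero_iff: "x \<in> A \<Longrightarrow> neg x = zero \<longleftrightarrow> x = one"
  by (metis neg_neg neg_one neg_zero)

text \<open>At \<open>y = one\<close>, one side of the Lukasiewicz axiom collapses to
  \<open>one\<close>, the other to \<open>add (neg x) x\<close>.\<close>

lemma neg_add_self: "x \<in> A \<Longrightarrow> add (neg x) x = one"
  using lukasiewicz[of x one] by simp

lemma add_neg_self: "x \<in> A \<Longrightarrow> add x (neg x) = one"
  using neg_add_self by (simp add: add_comm[of x "neg x"])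

section \<open>Truncated difference, natural order and orthogonality\<close>

lemma diff_closed [simp]: "x \<in> A \<Longrightarrow> y \<in> A \<Longrightarrow> diff x y \<in> A"
  by (simp add: diff_def)

lemma orth_comm: "x \<in> A \<Longrightarrow> y \<in> A \<Longrightarrow> orth x y \<longleftrightarrow> orth y x"
  by (simp add: orth_def add_comm[of "neg x" "neg y"])

text \<open>Both sides are the join of \<open>x\<close> and \<open>y\<close> in the natural
  order.\<close>

lemma diff_add_swap: "x \<in> A \<Longrightarrow> y \<in> A \<Longrightarrow> add (diff x y) y = add (diff y x) x"
  by (simp add: diff_def lukasiewicz)

text \<open>The hypothesis is \<open>x \<le> y\<close> in the natural order; it makes
  \<open>diff x y\<close> vanish, so the join reduces to \<open>y\<close>.\<close>

lemma add_diff_cancel: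
  assumes "x \<in> A" "y \<in> A" "add (neg x) y = one"
  shows "add x (diff y x) = y"
proof -
  have "diff x y = zero" using assms by (simp add: diff_def)
  then show ?thesis
    using assms diff_add_swap[of x y] add_comm[of x "diff y x"] by simp
qed

text \<open>Turns the natural order into the existence of a summand; the canonical witness is
  \<open>diff y x\<close>.\<close>

lemma neg_add_eq_one_iff:
  assumes "x \<in> A" "y \<in> A"
  shows "add (neg x) y = one \<longleftrightarrow> (\<exists>w\<in>A. add x w = y)"
proof
  assume "add (neg x) y = one"
  then show "\<exists>w\<in>A. add x w = y"
    using add_diff_cancel assms by (intro bexI[of _ "diff y x"]) auto
next
  assume "\<exists>w\<in>A. add x w = y"
  then show "add (neg x) y = one"
    using assms by (auto simp: add_assoc[symmetric] neg_add_self)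
qed

lemma add_diff_add:
  assumes "x \<in> A" "w \<in> A"
  shows "add x (diff (add x w) x) = add x w"
  using assms by (intro add_diff_cancel) (auto simp: neg_add_eq_one_iff)

text \<open>The complement of \<open>diff y x\<close> is \<open>add (neg y) x\<close>, whose summand
  \<open>x\<close> already completes \<open>neg x\<close> to \<open>one\<close>.\<close>

lemma orth_diff:
  assumes "x \<in> A" "y \<in> A"
  shows "orth x (diff y x)"
proof -
  have "add (neg x) (add (neg y) x) = add (add (neg x) x) (neg y)"
    using assms by (simp add: add_ac)
  then show ?thesis using assms by (simp add: orth_def diff_def neg_add_self)
qed

text \<open>In the Lukasiewicz axiom at \<open>neg y\<close> and \<open>x\<close>, orthogonality
  produces \<open>neg one = zero\<close>, leaving \<open>neg y\<close>. Cancellation in orthogonal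
  sums follows.\<close>

lemma diff_add_left:
  assumes "x \<in> A" "y \<in> A" "orth x y"
  shows "diff (add x y) x = y"
proof -
  have "add (neg (add x y)) x = add (neg (add (neg x) (neg y))) (neg y)"
    using lukasiewicz[of "neg y" x] assms by (simp add: add_comm)
  also have "\<dots> = neg y" using assms by (simp add: orth_def)
  finally show ?thesis using assms by (simp add: diff_def)
qed

lemma orth_cancel:
  assumes "x \<in> A" "y \<in> A" "z \<in> A" "orth x y" "orth x z" "add x y = add x z"
  shows "y = z"
  using assms diff_add_left by metis

text \<open>Since \<open>neg (add y z)\<close> lies below \<open>neg y\<close>, replacing the former
  by the latter keeps the sum equal to \<open>one\<close>.\<close>

lemma orth_addD:
  assumes "x \<in> A" "y \<in> A" "z \<in> A" "orth x (add y z)"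
  shows "orth x y"
proof -
  have "add (neg (neg (add y z))) (neg y) = add (add (neg y) y) z"
    using assms by (simp add: add_ac)
  then have "add (neg (neg (add y z))) (neg y) = one"
    using assms by (simp add: neg_add_self)
  then obtain u where "u \<in> A" "add (neg (add y z)) u = neg y"
    using neg_add_eq_one_iff[of "neg (add y z)" "neg y"] assms by auto
  then have "add (neg x) (neg y) = add (add (neg x) (neg (add y z))) u"
    using assms by (simp add: add_assoc)
  then show ?thesis using assms \<open>u \<in> A\<close> by (simp add: orth_def)
qed

text \<open>This description mentions neither the complement nor the unit, so it can be compared
  between different intervals of an EMV-algebra.\<close>

lemma orth_iff_least:
  assumes "x \<in> A" "y \<in> A"
  shows "orth x y \<longleftrightarrow> (\<forall>w\<in>A. add x w = add x y \<longrightarrow> (\<exists>v\<in>A. add y v = w))"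
proof
  assume orth: "orth x y"
  have "add (neg y) w = one" if w: "w \<in> A" "add x w = add x y" for w
  proof -
    have "neg y = add (neg (add x w)) x"
      using diff_add_left[OF assms orth] w assms
      by (metis add_closed diff_def neg_closed neg_neg)
    then have "add (neg y) w = add (neg (add x w)) (add x w)"
      using w assms by (simp only: add_assoc neg_closed add_closed)
    then show ?thesis using w assms by (simp only: neg_add_self add_closed)
  qed
  then show "\<forall>w\<in>A. add x w = add x y \<longrightarrow> (\<exists>v\<in>A. add y v = w)"
    using neg_add_eq_one_iff assms by blast
next
  assume least: "\<forall>w\<in>A. add x w = add x y \<longrightarrow> (\<exists>v\<in>A. add y v = w)"
  \<comment> \<open>Minimality is tested on the difference, which has the same sum with
    \<open>x\<close> and is orthogonal to it; orthogonality then descends to the summand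
    \<open>y\<close>.\<close>
  obtain v where "v \<in> A" "add y v = diff (add x y) x"
    using least add_diff_add[OF assms] assms by auto
  then show "orth x y"
    using orth_addD[of x y v] orth_diff[of x "add x y"] assms by simp
qed

text \<open>Let \<open>u\<close> fill \<open>x\<close> up to \<open>neg (add y z)\<close>. Adding
  \<open>y\<close> yields \<open>neg z\<close> because \<open>y\<close> and \<open>z\<close> are
  orthogonal, so \<open>add x y\<close> is below \<open>neg z\<close>.\<close>

lemma orth_assoc:
  assumes "x \<in> A" "y \<in> A" "z \<in> A" "orth y z" "orth x (add y z)"
  shows "orth (add x y) z"
proof -
  obtain u where u: "u \<in> A" "add x u = neg (add y z)"
    using neg_add_eq_one_iff[of x "neg (add y z)"] assms by (auto simp: orth_def)
  have "add (add x y) u = add (add x u) y"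
    using u(1) assms by (simp add: add_ac)
  also have "\<dots> = add (neg (add y z)) y" by (simp only: u(2))
  also have "\<dots> = add (neg (add (neg y) (neg z))) (neg z)"
    using lukasiewicz[of "neg z" y] assms by (simp add: add_comm)
  also have "\<dots> = neg z" using assms by (simp add: orth_def)
  finally show ?thesis
    using neg_add_eq_one_iff[of "add x y" "neg z"] assms u by (auto simp: orth_def)
qed

text \<open>Monotonicity of truncated subtraction: swapping the join of \<open>add p q\<close> and
  \<open>x\<close> brings out a summand \<open>p\<close>, which completes \<open>neg p\<close> to
  \<open>one\<close>.\<close>

lemma diff_add_le:
  assumes "p \<in> A" "q \<in> A" "x \<in> A"
  shows "\<exists>w\<in>A. add (diff p x) w = diff (add p q) x"
proof -
  let ?r = "add p q"
  have "add (neg (diff p x)) (diff ?r x) = add (neg p) (add (diff ?r x) x)"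
    using assms by (simp add: diff_def add_ac)
  also have "\<dots> = add (neg p) (add (diff x ?r) ?r)"
    using assms by (simp add: diff_add_swap)
  also have "\<dots> = add (add (neg p) p) (add (diff x ?r) q)"
    using assms by (simp add: add_ac)
  also have "\<dots> = one" using assms by (simp add: neg_add_self)
  finally show ?thesis
    using neg_add_eq_one_iff[of "diff p x" "diff ?r x"] assms by simp
qed

text \<open>Both sides are the meet of \<open>p\<close> and \<open>x\<close>, by the Lukasiewicz
  axiom at the complements.\<close>

lemma diff_diff_swap:
  assumes "p \<in> A" "x \<in> A"
  shows "diff p (diff p x) = diff x (diff x p)"
  using assms lukasiewicz[of "neg x" "neg p"]
  by (simp add: diff_def add_comm)

text \<open>Take \<open>a\<close> as the meet of \<open>p\<close> and \<open>x\<close>,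
  \<open>b\<close> and \<open>c\<close> as their two differences, and \<open>d\<close> as the
  remainder of \<open>y\<close> after \<open>b\<close>. The point is that \<open>d\<close> is also
  the remainder of \<open>q\<close> after \<open>c\<close>.\<close>

lemma riesz_refinement:
  assumes "p \<in> A" "q \<in> A" "x \<in> A" "y \<in> A" "orth p q" "orth x y" "add p q = add x y"
  obtains a b c d where "a \<in> A" "b \<in> A" "c \<in> A" "d \<in> A"
    "orth a b" "orth c d" "orth a c" "orth b d"
    "p = add a b" "q = add c d" "x = add a c" "y = add b d"
proof -
  define b where "b = diff p x"
  define c where "c = diff x p"
  define a where "a = diff p b"
  have a': "a = diff x c" using diff_diff_swap assms by (simp add: a_def b_def c_def)
  have cl: "a \<in> A" "b \<in> A" "c \<in> A" using assms by (auto simp: a_def b_def c_def)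
  have le: "add (neg (diff u v)) u = one" if "u \<in> A" "v \<in> A" for u v
  proof -
    have "add (neg (diff u v)) u = add (add (neg u) u) v"
      using that by (simp add: diff_def add_ac)
    then show ?thesis using that by (simp add: neg_add_self)
  qed
  have p: "add b a = p" "orth b a"
    using add_diff_cancel[of b p] orth_diff[of b p] le[of p x] assms cl by (auto simp: a_def b_def)
  have x: "add c a = x" "orth c a"
    using add_diff_cancel[of c x] orth_diff[of c x] le[of x p] assms cl by (auto simp: a' c_def)
  \<comment> \<open>By monotonicity, \<open>b = diff p x\<close> is below
    \<open>diff (add x y) x\<close>, which is \<open>y\<close>.\<close>
  have "\<exists>w\<in>A. add b w = y"
    using diff_add_le[of p q x] diff_add_left[of x y] assms by (simp add: b_def)
  then have y: "add b (diff y b) = y" "orth b (diff y b)"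
    using add_diff_cancel[of b y] neg_add_eq_one_iff[of b y] orth_diff[of b y] cl assms by auto
  have "\<exists>w\<in>A. add c w = q"
    using diff_add_le[of x y p] diff_add_left[of p q] assms by (simp add: c_def)
  then have q: "add c (diff q c) = q" "orth c (diff q c)"
    using add_diff_cancel[of c q] neg_add_eq_one_iff[of c q] orth_diff[of c q] cl assms by auto
  \<comment> \<open>\<open>t\<close> is the join of \<open>p\<close> and \<open>x\<close>. Both
    remainders are orthogonal to it and complete it to the same total, so cancellation identifies
    them.\<close>
  define t where "t = add x b"
  have t: "t = add p c"
    using cl by (simp add: t_def add_ac flip: p(1) x(1))
  have "orth t (diff y b)"
    unfolding t_def using orth_assoc[of x b "diff y b"] y assms cl by simp
  moreover have "orth t (diff q c)"
    unfolding t using orth_assoc[of p c "diff q c"] q assms cl by simp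
  moreover have "add t (diff y b) = add x y"
    unfolding t_def using y assms cl by (simp add: add_assoc)
  moreover have "add t (diff q c) = add p q"
    unfolding t using q assms cl by (simp add: add_assoc)
  moreover have "t \<in> A" using cl assms by (simp add: t_def)
  ultimately have yq: "diff y b = diff q c"
    using orth_cancel[of t "diff y b" "diff q c"] assms cl by simp
  show ?thesis
  proof (rule that[of a b c "diff y b"])
    show "orth a b" "orth a c" using p x cl orth_comm by blast+
    show "p = add a b" "x = add a c" using p(1) x(1) cl add_comm by metis+
    show "orth c (diff y b)" "q = add c (diff y b)" using q by (simp_all add: yq)
  qed (use cl y assms in auto)
qed

end

section \<open>The partial addition of an EMV-algebra\<close>

context emv_algebra
begin

section \<open>Order, idempotents and common intervals\<close>

lemma emv_le_trans:
  assumes "x \<in> carrier M" "y \<in> carrier M" "z \<in> carrier M" "x \<preceq> y" "y \<preceq> z"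
  shows "x \<preceq> z"
  using assms unfolding emv_le_def by (metis wedge_assoc)

lemma emv_le_antisym:
  "x \<in> carrier M \<Longrightarrow> y \<in> carrier M \<Longrightarrow> x \<preceq> y \<Longrightarrow> y \<preceq> x \<Longrightarrow> x = y"
  unfolding emv_le_def by (metis wedge_comm)

lemma below_iff: "x \<in> below M a \<longleftrightarrow> x \<in> carrier M \<and> x \<preceq> a"
  by (auto simp: below_def zero_le)

lemma idempotents_carrier: "a \<in> idempotents M \<Longrightarrow> a \<in> carrier M"
  by (simp add: idempotents_def)

lemma below_mono:
  "a \<in> idempotents M \<Longrightarrow> c \<in> idempotents M \<Longrightarrow> a \<preceq> c \<Longrightarrow> below M a \<subseteq> below M c"
  unfolding below_iff subset_iff using emv_le_trans idempotents_carrier by blast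

lemma zero_carrier: "\<zero> \<in> carrier M"
  using monoid.one_closed[OF comm_monoid.axioms(1)[OF oplus_monoid]] by simp

lemma oplus_closed: "x \<in> carrier M \<Longrightarrow> y \<in> carrier M \<Longrightarrow> x \<oplus> y \<in> carrier M"
  using monoid.m_closed[OF comm_monoid.axioms(1)[OF oplus_monoid]] by simp

lemma oplus_assoc:
  "x \<in> carrier M \<Longrightarrow> y \<in> carrier M \<Longrightarrow> z \<in> carrier M \<Longrightarrow> x \<oplus> y \<oplus> z = x \<oplus> (y \<oplus> z)"
  using monoid.m_assoc[OF comm_monoid.axioms(1)[OF oplus_monoid]] by simp

lemma common_idempotent2:
  assumes "x \<in> carrier M" "y \<in> carrier M"
  shows "\<exists>a\<in>idempotents M. x \<preceq> a \<and> y \<preceq> a"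
proof -
  have "x \<curlyvee> y \<in> carrier M" "x \<preceq> x \<curlyvee> y" "y \<preceq> x \<curlyvee> y"
    using assms vee_closed wedge_vee_absorb[of x y] wedge_vee_absorb[of y x] vee_comm[of x y]
    by (auto simp: emv_le_def)
  moreover obtain a where "a \<in> idempotents M" "x \<curlyvee> y \<preceq> a"
    using idempotent_above calculation(1) by blast
  ultimately show ?thesis
    using emv_le_trans[OF _ \<open>x \<curlyvee> y \<in> carrier M\<close> idempotents_carrier] assms by blast
qed

text \<open>Places finitely many elements in one MV-algebra, where orthogonality and refinement are
  available.\<close>

lemma common_idempotent:
  assumes "finite F" "F \<subseteq> carrier M"
  shows "\<exists>a\<in>idempotents M. F \<subseteq> below M a"
  using assms
proof (induction F rule: finite_induct)
  case empty
  then show ?case using idempotent_above[OF zero_carrier] by auto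
next
  case (insert x F)
  then obtain a where a: "a \<in> idempotents M" "F \<subseteq> below M a" by auto
  obtain c where c: "c \<in> idempotents M" "x \<preceq> c" "a \<preceq> c"
    using common_idempotent2[of x a] insert.prems idempotents_carrier[OF a(1)] by auto
  have "insert x F \<subseteq> below M c"
    using below_mono[OF a(1) c(1,3)] a insert.prems c by (auto simp: below_iff)
  then show ?case using c by blast
qed

section \<open>Independence of the partial sum from the interval\<close>

lemma lam_minimum:
  assumes "a \<in> idempotents M" "x \<in> below M a"
  shows "is_minimum M (lam M a x) (complements M a x)"
proof -
  obtain z where z: "is_minimum M z (complements M a x)" using lam_exists[OF assms] by blast
  \<comment> \<open>Antisymmetry gives the uniqueness that \<open>THE\<close> requires.\<close>
  have "y = z" if "is_minimum M y (complements M a x)" for y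
    using z that by (auto simp: is_minimum_def complements_def below_iff intro: emv_le_antisym)
  then have "lam M a x = z" unfolding lam_def using z by (intro the_equality)
  then show ?thesis using z by simp
qed

text \<open>The lattice order is not required to be the natural order of the MV-algebra \<open>[0, c]\<close>, but it
  extends it, because \<open>lam\<close> is a minimum for the lattice order; hence \<open>[0, a]\<close> is closed under
  summands.\<close>

lemma below_summand:
  assumes a: "a \<in> idempotents M" and c: "c \<in> idempotents M" and ac: "a \<preceq> c"
    and w: "w \<in> below M c" and x: "x \<in> below M c" and wx: "w \<oplus> x \<in> below M a"
  shows "w \<in> below M a"
proof -
  interpret A: mv_algebra "below M a" "(\<oplus>)" "lam M a" "\<zero>" a by (rule interval_mv[OF a])
  interpret C: mv_algebra "below M c" "(\<oplus>)" "lam M c" "\<zero>" c by (rule interval_mv[OF c])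
  \<comment> \<open>The complement is taken in \<open>[0, a]\<close>, so that
    \<open>w \<oplus> v = a\<close> puts \<open>w\<close> below \<open>a\<close> in the natural
    order of \<open>[0, c]\<close>.\<close>
  define v where "v = x \<oplus> lam M a (w \<oplus> x)"
  have l: "lam M a (w \<oplus> x) \<in> below M c"
    using below_mono[OF a c ac] wx A.neg_closed by blast
  then have v: "v \<in> below M c" using x by (simp add: v_def)
  have aC: "a \<in> below M c" using a ac by (simp add: below_iff idempotents_carrier)
  have "w \<oplus> v = a"
    using A.add_neg_self[OF wx] C.add_assoc[OF w x l] by (simp add: v_def)
  then have "lam M c w \<oplus> a = c"
    using C.neg_add_eq_one_iff[OF w aC] v by blast
  \<comment> \<open>Thus \<open>a\<close> competes in the minimum defining the complement of
    \<open>lam M c w\<close>, and that minimum is \<open>w\<close>.\<close>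
  then have "a \<in> complements M c (lam M c w)"
    using aC w C.add_comm[of "lam M c w" a] by (simp add: complements_def)
  then have "lam M c (lam M c w) \<preceq> a"
    using lam_minimum[OF c C.neg_closed[OF w]] by (simp add: is_minimum_def)
  then show ?thesis using w by (simp add: below_iff)
qed

text \<open>In \<open>orth_iff_least\<close> the interval enters only as the range of
  \<open>w\<close> and \<open>v\<close>. Both are summands of elements of \<open>[0, a]\<close>, so
  by \<open>below_summand\<close> either interval gives the same condition.\<close>

lemma orth_interval_independent:
  assumes a: "a \<in> idempotents M" and c: "c \<in> idempotents M" and ac: "a \<preceq> c"
    and x: "x \<in> below M a" and y: "y \<in> below M a"
  shows "mv_algebra.orth (\<oplus>) (lam M a) a x y \<longleftrightarrow> mv_algebra.orth (\<oplus>) (lam M c) c x y"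
proof -
  interpret A: mv_algebra "below M a" "(\<oplus>)" "lam M a" "\<zero>" a by (rule interval_mv[OF a])
  interpret C: mv_algebra "below M c" "(\<oplus>)" "lam M c" "\<zero>" c by (rule interval_mv[OF c])
  have sub: "\<And>u. u \<in> below M a \<Longrightarrow> u \<in> below M c" using below_mono[OF a c ac] by blast
  have summand: "w \<in> below M a" if "w \<in> below M c" "u \<in> below M a" "u \<oplus> w \<in> below M a" for u w
    using below_summand[OF a c ac that(1) sub[OF that(2)]] that(3)
      C.add_comm[OF that(1) sub[OF that(2)]] by simp
  show ?thesis
  proof
    assume orth: "A.orth x y"
    have "\<exists>v\<in>below M c. y \<oplus> v = w" if w: "w \<in> below M c" "x \<oplus> w = x \<oplus> y" for w
    proof -
      have "w \<in> below M a" using summand[OF w(1) x] w(2) A.add_closed[OF x y] by simp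
      then show ?thesis using orth w(2) sub unfolding A.orth_iff_least[OF x y] by blast
    qed
    then show "C.orth x y" unfolding C.orth_iff_least[OF sub[OF x] sub[OF y]] by blast
  next
    assume orth: "C.orth x y"
    have "\<exists>v\<in>below M a. y \<oplus> v = w" if w: "w \<in> below M a" "x \<oplus> w = x \<oplus> y" for w
    proof -
      obtain v where v: "v \<in> below M c" "y \<oplus> v = w"
        using orth w sub unfolding C.orth_iff_least[OF sub[OF x] sub[OF y]] by blast
      then have "v \<in> below M a" using summand[OF v(1) y] w(1) by simp
      then show ?thesis using v(2) by blast
    qed
    then show "A.orth x y" unfolding A.orth_iff_least[OF x y] by blast
  qed
qed

text \<open>The idempotent picked by \<open>SOME\<close> is compared with \<open>a\<close> through a
  third one above both.\<close>

lemma plus_defined_iff_orth: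
  assumes a: "a \<in> idempotents M" and x: "x \<in> below M a" and y: "y \<in> below M a"
  shows "plus_defined M x y \<longleftrightarrow> mv_algebra.orth (\<oplus>) (lam M a) a x y"
proof -
  define b where "b = (SOME b. b \<in> idempotents M \<and> x \<preceq> b \<and> y \<preceq> b)"
  have xy: "x \<in> carrier M" "y \<in> carrier M" using x y by (auto simp: below_iff)
  have "\<exists>b. b \<in> idempotents M \<and> x \<preceq> b \<and> y \<preceq> b"
    using common_idempotent2[OF xy] by blast
  then have "b \<in> idempotents M \<and> x \<preceq> b \<and> y \<preceq> b"
    unfolding b_def by (rule someI_ex)
  then have b: "b \<in> idempotents M" "x \<in> below M b" "y \<in> below M b"
    using xy by (auto simp: below_iff)
  interpret B: mv_algebra "below M b" "(\<oplus>)" "lam M b" "\<zero>" b by (rule interval_mv[OF b(1)])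
  obtain c where c: "c \<in> idempotents M" "a \<preceq> c" "b \<preceq> c"
    using common_idempotent2[OF idempotents_carrier[OF a] idempotents_carrier[OF b(1)]] by blast
  have "plus_defined M x y \<longleftrightarrow> B.orth x y"
    using xy b B.neg_eq_zero_iff[of "lam M b x \<oplus> lam M b y"]
    by (simp add: plus_defined_def odot_def B.orth_def Let_def flip: b_def)
  also have "\<dots> \<longleftrightarrow> mv_algebra.orth (\<oplus>) (lam M c) c x y"
    by (rule orth_interval_independent[OF b(1) c(1,3) b(2,3)])
  also have "\<dots> \<longleftrightarrow> mv_algebra.orth (\<oplus>) (lam M a) a x y"
    by (rule orth_interval_independent[OF a c(1,2) x y, symmetric])
  finally show ?thesis .
qed

lemma plus_defined_carrier:
  assumes "plus_defined M x y"
  shows "x \<in> carrier M" "y \<in> carrier M" "x \<oplus> y \<in> carrier M"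
  using assms oplus_closed by (auto simp: plus_defined_def)

text \<open>Rebrackets to the left, the form in which decompositions are built.\<close>

lemma plus_defined_assoc:
  assumes yz: "plus_defined M y z" and x_yz: "plus_defined M x (y \<oplus> z)"
  shows "plus_defined M x y" "plus_defined M (x \<oplus> y) z"
proof -
  have "{x, y, z} \<subseteq> carrier M"
    using plus_defined_carrier[OF yz] plus_defined_carrier[OF x_yz] by auto
  then obtain a where a: "a \<in> idempotents M" "{x, y, z} \<subseteq> below M a"
    using common_idempotent[of "{x, y, z}"] by auto
  interpret A: mv_algebra "below M a" "(\<oplus>)" "lam M a" "\<zero>" a by (rule interval_mv[OF a(1)])
  have orth: "plus_defined M u v \<longleftrightarrow> A.orth u v" if "u \<in> below M a" "v \<in> below M a" for u v
    using plus_defined_iff_orth a that by blast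
  show "plus_defined M x y" "plus_defined M (x \<oplus> y) z"
    using a(2) yz x_yz A.orth_addD[of x y z] A.orth_assoc[of x y z] by (auto simp: orth)
qed

lemma partial_riesz_refinement:
  assumes pq: "plus_defined M p q" and xy: "plus_defined M x y" and eq: "p \<oplus> q = x \<oplus> y"
  obtains a b c d where "plus_defined M a b" "plus_defined M c d"
    "plus_defined M a c" "plus_defined M b d"
    "p = a \<oplus> b" "q = c \<oplus> d" "x = a \<oplus> c" "y = b \<oplus> d"
proof -
  have "{p, q, x, y} \<subseteq> carrier M"
    using plus_defined_carrier[OF pq] plus_defined_carrier[OF xy] by auto
  then obtain e where e: "e \<in> idempotents M" "{p, q, x, y} \<subseteq> below M e"
    using common_idempotent[of "{p, q, x, y}"] by auto
  interpret E: mv_algebra "below M e" "(\<oplus>)" "lam M e" "\<zero>" e by (rule interval_mv[OF e(1)])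
  have orth: "plus_defined M u v \<longleftrightarrow> E.orth u v" if "u \<in> below M e" "v \<in> below M e" for u v
    using plus_defined_iff_orth e that by blast
  have "p \<in> below M e" "q \<in> below M e" "x \<in> below M e" "y \<in> below M e" using e by auto
  moreover have "E.orth p q" "E.orth x y" using calculation pq xy orth by simp_all
  ultimately obtain a b c d where "a \<in> below M e" "b \<in> below M e" "c \<in> below M e" "d \<in> below M e"
    "E.orth a b" "E.orth c d" "E.orth a c" "E.orth b d"
    "p = a \<oplus> b" "q = c \<oplus> d" "x = a \<oplus> c" "y = b \<oplus> d"
    using E.riesz_refinement[of p q x y] eq by blast
  then show thesis using that[of a b c d] orth by simp
qed

section \<open>Decompositions into partial sums\<close>

lemma partial_sum_carrier: "is_partial_sum M xs x \<Longrightarrow> x \<in> carrier M \<and> set xs \<subseteq> carrier M"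
  by (induction rule: is_partial_sum.induct) (auto dest: plus_defined_carrier)

text \<open>Induction on \<open>ys\<close>: reassociation keeps its last term outermost.\<close>

lemma partial_sum_append:
  assumes "is_partial_sum M ys y" "is_partial_sum M xs x" "plus_defined M x y"
  shows "is_partial_sum M (xs @ ys) (x \<oplus> y)"
  using assms
proof (induction rule: is_partial_sum.induct)
  case (single y)
  then show ?case by (intro is_partial_sum.snoc)
next
  case (snoc ys y z)
  note assoc = plus_defined_assoc[OF snoc.hyps(2) snoc.prems(2)]
  have "is_partial_sum M ((xs @ ys) @ [z]) (x \<oplus> y \<oplus> z)"
    using snoc.IH[OF snoc.prems(1) assoc(1)] assoc(2) by (rule is_partial_sum.snoc)
  then show ?case
    using oplus_assoc[of x y z] plus_defined_carrier[OF assoc(1)] plus_defined_carrier[OF assoc(2)]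
    by simp
qed

text \<open>The last step \<open>p + q\<close> is refined against \<open>x + y\<close>. The
  induction hypothesis, for arbitrary summands, splits \<open>p\<close> along \<open>a\<close> and
  \<open>b\<close>; then \<open>c\<close> and \<open>d\<close> are appended at the cost of
  subadditivity at \<open>q\<close>.\<close>

lemma partial_sum_split:
  fixes f :: "'a \<Rightarrow> real"
  assumes "is_partial_sum M zs z" "plus_defined M x y" "z = x \<oplus> y"
    and sub: "\<And>x y. plus_defined M x y \<Longrightarrow> f (x \<oplus> y) \<le> f x + f y"
  shows "\<exists>xs ys. is_partial_sum M xs x \<and> is_partial_sum M ys y \<and>
    sum_list (map f zs) \<le> sum_list (map f xs) + sum_list (map f ys)"
  using assms(1-3)
proof (induction arbitrary: x y rule: is_partial_sum.induct)
  case (single z)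
  then have "is_partial_sum M [x] x" "is_partial_sum M [y] y"
    using plus_defined_carrier by (auto intro: is_partial_sum.single)
  then show ?case
    using sub[OF single.prems(1)] single.prems(2) by (intro exI[of _ "[x]"] exI[of _ "[y]"]) simp
next
  case (snoc zs p q)
  obtain a b c d where r: "plus_defined M a b" "plus_defined M c d"
    "plus_defined M a c" "plus_defined M b d"
    "p = a \<oplus> b" "q = c \<oplus> d" "x = a \<oplus> c" "y = b \<oplus> d"
    by (rule partial_riesz_refinement[OF snoc.hyps(2) snoc.prems])
  obtain xs ys where xs: "is_partial_sum M xs a" and ys: "is_partial_sum M ys b"
    and le: "sum_list (map f zs) \<le> sum_list (map f xs) + sum_list (map f ys)"
    using snoc.IH[OF r(1,5)] by blast
  have "is_partial_sum M (xs @ [c]) x" "is_partial_sum M (ys @ [d]) y"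
    unfolding r(7,8) using xs ys r by (auto intro: is_partial_sum.snoc)
  then show ?case
    using le sub[OF r(2)] r(6) by (intro exI[of _ "xs @ [c]"] exI[of _ "ys @ [d]"]) simp
qed

section \<open>Jordan signed measures\<close>

lemma signed_measure_plus:
  "m \<in> signed_measures M \<Longrightarrow> plus_defined M x y \<Longrightarrow> m (x \<oplus> y) = m x + m y"
  by (simp add: signed_measures_def)

lemma signed_measure_partial_sum:
  assumes "m \<in> signed_measures M" "is_partial_sum M xs x"
  shows "sum_list (map m xs) = m x"
  using assms(2) by induction (auto simp: signed_measure_plus[OF assms(1)])

lemma decomposition_sums_nonempty: "x \<in> carrier M \<Longrightarrow> f x \<in> decomposition_sums M f x"
  unfolding decomposition_sums_def
  by (rule CollectI, rule exI[of _ "[x]"]) (auto intro: is_partial_sum.single)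

text \<open>An additive \<open>u\<close> has the same total on every decomposition, so termwise
  comparison suffices. This yields both boundedness and leastness of the supremum.\<close>

lemma decomposition_sums_le:
  assumes u: "u \<in> signed_measures M" and le: "\<And>z. z \<in> carrier M \<Longrightarrow> f z \<le> u z"
    and t: "t \<in> decomposition_sums M f x"
  shows "t \<le> u x"
proof -
  obtain xs where xs: "is_partial_sum M xs x" "t = sum_list (map f xs)"
    using t by (auto simp: decomposition_sums_def)
  have "t \<le> sum_list (map u xs)"
    unfolding xs(2) using partial_sum_carrier[OF xs(1)] le by (intro sum_list_mono) auto
  then show ?thesis using signed_measure_partial_sum[OF u xs(1)] by simp
qed

lemma Sup_decomposition_sums_plus:
  assumes u: "u \<in> signed_measures M" and le: "\<And>z. z \<in> carrier M \<Longrightarrow> f z \<le> u z"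
    and sub: "\<And>x y. plus_defined M x y \<Longrightarrow> f (x \<oplus> y) \<le> f x + f y"
    and xy: "plus_defined M x y"
  shows "Sup (decomposition_sums M f (x \<oplus> y)) =
    Sup (decomposition_sums M f x) + Sup (decomposition_sums M f y)"
proof (rule antisym)
  let ?D = "decomposition_sums M f"
  have bdd: "bdd_above (?D z)" for z
    using decomposition_sums_le[OF u le] by (intro bdd_aboveI) blast
  have ne: "?D z \<noteq> {}" if "z \<in> carrier M" for z
    using decomposition_sums_nonempty[OF that] by blast
  note cl = plus_defined_carrier[OF xy]
  show "Sup (?D (x \<oplus> y)) \<le> Sup (?D x) + Sup (?D y)"
  proof (rule cSup_least[OF ne[OF cl(3)]])
    fix t assume "t \<in> ?D (x \<oplus> y)"
    then obtain zs where zs: "is_partial_sum M zs (x \<oplus> y)" "t = sum_list (map f zs)"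
      by (auto simp: decomposition_sums_def)
    obtain xs ys where s: "is_partial_sum M xs x" "is_partial_sum M ys y"
      and t: "t \<le> sum_list (map f xs) + sum_list (map f ys)"
      using partial_sum_split[OF zs(1) xy refl sub] zs(2) by blast
    have "sum_list (map f xs) \<le> Sup (?D x)" "sum_list (map f ys) \<le> Sup (?D y)"
      using s bdd by (auto intro!: cSup_upper simp: decomposition_sums_def)
    then show "t \<le> Sup (?D x) + Sup (?D y)" using t by simp
  qed
  have "s + t \<le> Sup (?D (x \<oplus> y))" if st: "s \<in> ?D x" "t \<in> ?D y" for s t
  proof -
    obtain xs ys where "is_partial_sum M xs x" "s = sum_list (map f xs)"
      "is_partial_sum M ys y" "t = sum_list (map f ys)"
      using st by (auto simp: decomposition_sums_def)
    then have "s + t \<in> ?D (x \<oplus> y)"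
      using partial_sum_append[OF _ _ xy] unfolding decomposition_sums_def
      by (intro CollectI exI[of _ "xs @ ys"]) auto
    then show ?thesis using bdd by (rule cSup_upper)
  qed
  \<comment> \<open>The suprema over \<open>s\<close> and \<open>t\<close> are taken one at a time,
    moving the other term across the inequality.\<close>
  then have "s \<le> Sup (?D (x \<oplus> y)) - t" if "s \<in> ?D x" "t \<in> ?D y" for s t
    using that by (simp add: le_diff_eq)
  then have "Sup (?D x) \<le> Sup (?D (x \<oplus> y)) - t" if "t \<in> ?D y" for t
    using that ne[OF cl(1)] by (intro cSup_least) auto
  then have "t \<le> Sup (?D (x \<oplus> y)) - Sup (?D x)" if "t \<in> ?D y" for t
    using that by (simp add: le_diff_eq add.commute)
  then have "Sup (?D y) \<le> Sup (?D (x \<oplus> y)) - Sup (?D x)"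
    using ne[OF cl(2)] by (intro cSup_least) auto
  then show "Sup (?D x) + Sup (?D y) \<le> Sup (?D (x \<oplus> y))" by simp
qed

section \<open>Closure properties of measures\<close>

lemma signed_measuresI:
  assumes "\<And>x y. plus_defined M x y \<Longrightarrow> g (x \<oplus> y) = g x + g y"
  shows "restrict g (carrier M) \<in> signed_measures M"
  using assms plus_defined_carrier by (auto simp: signed_measures_def)

lemma signed_measures_add:
  assumes "m1 \<in> signed_measures M" "m2 \<in> signed_measures M"
  shows "(\<lambda>x\<in>carrier M. m1 x + m2 x) \<in> signed_measures M"
  using assms by (intro signed_measuresI) (simp add: signed_measure_plus)

lemma signed_measures_uminus:
  assumes "m \<in> signed_measures M"
  shows "(\<lambda>x\<in>carrier M. - m x) \<in> signed_measures M"
  using assms by (intro signed_measuresI) (simp add: signed_measure_plus)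

lemma signed_measures_ext:
  assumes "m1 \<in> signed_measures M" "m2 \<in> signed_measures M"
    "\<And>x. x \<in> carrier M \<Longrightarrow> m1 x = m2 x"
  shows "m1 = m2"
  using assms unfolding signed_measures_def by (auto intro: PiE_ext)

lemma measures_on_add:
  assumes "m1 \<in> measures_on M" "m2 \<in> measures_on M"
  shows "(\<lambda>x\<in>carrier M. m1 x + m2 x) \<in> measures_on M"
  using assms signed_measures_add by (auto simp: measures_on_def)

lemma jordan_measures_signed: "m \<in> jordan_measures M \<Longrightarrow> m \<in> signed_measures M"
  by (simp add: jordan_measures_def)

lemma jordan_measuresE:
  assumes "m \<in> jordan_measures M"
  obtains m1 m2 where "m1 \<in> measures_on M" "m2 \<in> measures_on M"
    "\<And>x. x \<in> carrier M \<Longrightarrow> m x = m1 x - m2 x"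
  using assms unfolding jordan_measures_def by blast

lemma jordan_measuresI:
  assumes "m \<in> signed_measures M" "m1 \<in> measures_on M" "m2 \<in> measures_on M"
    "\<And>x. x \<in> carrier M \<Longrightarrow> m x = m1 x - m2 x"
  shows "m \<in> jordan_measures M"
  using assms by (auto simp: jordan_measures_def)

lemma zero_measure: "(\<lambda>x\<in>carrier M. 0) \<in> measures_on M"
  unfolding measures_on_def using signed_measuresI[of "\<lambda>x. 0"] by simp

lemma measures_on_jordan: "m \<in> measures_on M \<Longrightarrow> m \<in> jordan_measures M"
  by (rule jordan_measuresI[OF _ _ zero_measure]) (auto simp: measures_on_def)

lemma jordan_measures_add:
  assumes "m \<in> jordan_measures M" "n \<in> jordan_measures M"
  shows "(\<lambda>x\<in>carrier M. m x + n x) \<in> jordan_measures M"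
proof -
  obtain m1 m2 where m: "m1 \<in> measures_on M" "m2 \<in> measures_on M"
    "\<And>x. x \<in> carrier M \<Longrightarrow> m x = m1 x - m2 x" using jordan_measuresE[OF assms(1)] by blast
  obtain n1 n2 where n: "n1 \<in> measures_on M" "n2 \<in> measures_on M"
    "\<And>x. x \<in> carrier M \<Longrightarrow> n x = n1 x - n2 x" using jordan_measuresE[OF assms(2)] by blast
  show ?thesis
    using signed_measures_add[OF assms[THEN jordan_measures_signed]]
      measures_on_add[OF m(1) n(1)] measures_on_add[OF m(2) n(2)]
    by (rule jordan_measuresI) (simp add: m n)
qed

lemma jordan_measures_uminus:
  assumes "m \<in> jordan_measures M"
  shows "(\<lambda>x\<in>carrier M. - m x) \<in> jordan_measures M"
proof -
  obtain m1 m2 where m: "m1 \<in> measures_on M" "m2 \<in> measures_on M"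
    "\<And>x. x \<in> carrier M \<Longrightarrow> m x = m1 x - m2 x" using jordan_measuresE[OF assms] by blast
  show ?thesis
    using signed_measures_uminus[OF jordan_measures_signed[OF assms]] m(2,1)
    by (rule jordan_measuresI) (simp add: m(3))
qed

text \<open>The difference of \<open>s\<close> and \<open>m\<close> is a measure, and adding it to
  \<open>m\<close> gives back \<open>s\<close>.\<close>

lemma jordan_measures_above:
  assumes s: "s \<in> signed_measures M" and m: "m \<in> jordan_measures M"
    and le: "\<And>x. x \<in> carrier M \<Longrightarrow> m x \<le> s x"
  shows "s \<in> jordan_measures M"
proof -
  let ?n = "\<lambda>x\<in>carrier M. s x + (\<lambda>x\<in>carrier M. - m x) x"
  have "?n \<in> signed_measures M"
    by (intro signed_measures_add s signed_measures_uminus jordan_measures_signed m)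
  then have "?n \<in> measures_on M" using le by (simp add: measures_on_def)
  then have "(\<lambda>x\<in>carrier M. m x + ?n x) \<in> jordan_measures M"
    by (intro jordan_measures_add m measures_on_jordan)
  moreover have "s = (\<lambda>x\<in>carrier M. m x + ?n x)"
    using calculation by (intro signed_measures_ext s jordan_measures_signed) simp_all
  ultimately show ?thesis by simp
qed

section \<open>Suprema and infima of bounded families\<close>

lemma jordan_order_simps [simp]:
  "carrier (jordan_order M) = jordan_measures M"
  "(.=\<^bsub>jordan_order M\<^esub>) = (=)"
  "m \<sqsubseteq>\<^bsub>jordan_order M\<^esub> n \<longleftrightarrow> (\<forall>x\<in>carrier M. m x \<le> n x)"
  by (simp_all add: jordan_order_def)

lemma jordan_group_simps [simp]:
  "carrier (jordan_group M) = jordan_measures M"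
  "m \<otimes>\<^bsub>jordan_group M\<^esub> n = (\<lambda>x\<in>carrier M. m x + n x)"
  "\<one>\<^bsub>jordan_group M\<^esub> = (\<lambda>x\<in>carrier M. 0)"
  by (simp_all add: jordan_group_def)

lemma is_lub_jordan_iff:
  assumes "F \<subseteq> jordan_measures M"
  shows "is_lub (jordan_order M) s F \<longleftrightarrow> s \<in> jordan_measures M \<and>
    (\<forall>m\<in>F. \<forall>x\<in>carrier M. m x \<le> s x) \<and>
    (\<forall>u\<in>jordan_measures M. (\<forall>m\<in>F. \<forall>x\<in>carrier M. m x \<le> u x) \<longrightarrow> (\<forall>x\<in>carrier M. s x \<le> u x))"
proof -
  have "Upper (jordan_order M) F = {u \<in> jordan_measures M. \<forall>m\<in>F. \<forall>x\<in>carrier M. m x \<le> u x}"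
    using assms by (auto simp: Upper_def; blast)
  then show ?thesis by (auto simp: least_def)
qed

lemma is_glb_jordan_iff:
  assumes "F \<subseteq> jordan_measures M"
  shows "is_glb (jordan_order M) s F \<longleftrightarrow> s \<in> jordan_measures M \<and>
    (\<forall>m\<in>F. \<forall>x\<in>carrier M. s x \<le> m x) \<and>
    (\<forall>u\<in>jordan_measures M. (\<forall>m\<in>F. \<forall>x\<in>carrier M. u x \<le> m x) \<longrightarrow> (\<forall>x\<in>carrier M. u x \<le> s x))"
proof -
  have "Lower (jordan_order M) F = {u \<in> jordan_measures M. \<forall>m\<in>F. \<forall>x\<in>carrier M. u x \<le> m x}"
    using assms by (auto simp: Lower_def; blast)
  then show ?thesis by (auto simp: greatest_def)
qed

text \<open>Boundedness is asserted with the value because a real \<open>Sup\<close> is a genuine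
  supremum only for a bounded set.\<close>

lemma jordan_lub:
  assumes F: "F \<subseteq> jordan_measures M" "F \<noteq> {}" "Upper (jordan_order M) F \<noteq> {}"
    and d: "\<forall>x\<in>carrier M. d x = (SUP m\<in>F. m x)"
  shows "\<exists>s. is_lub (jordan_order M) s F \<and>
    (\<forall>x\<in>carrier M. bdd_above (decomposition_sums M d x) \<and> s x = Sup (decomposition_sums M d x))"
proof -
  let ?D = "decomposition_sums M d"
  define s where "s = (\<lambda>x\<in>carrier M. Sup (?D x))"
  obtain u where u: "u \<in> jordan_measures M" "\<And>m x. m \<in> F \<Longrightarrow> x \<in> carrier M \<Longrightarrow> m x \<le> u x"
    using F by (fastforce simp: Upper_def)
  have d_upper: "m x \<le> d x" if "m \<in> F" "x \<in> carrier M" for m x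
    unfolding bspec[OF d that(2)] using u that by (intro cSUP_upper bdd_aboveI2[of _ _ "u x"]) auto
  have d_least: "d x \<le> c" if "x \<in> carrier M" "\<And>m. m \<in> F \<Longrightarrow> m x \<le> c" for x c
    unfolding bspec[OF d that(1)] using that F by (intro cSUP_least) auto
  have sub: "d (x \<oplus> y) \<le> d x + d y" if "plus_defined M x y" for x y
  proof (rule d_least)
    fix m assume m: "m \<in> F"
    then have "m (x \<oplus> y) = m x + m y"
      using F(1) that by (intro signed_measure_plus jordan_measures_signed) auto
    then show "m (x \<oplus> y) \<le> d x + d y"
      using d_upper[OF m] plus_defined_carrier[OF that] by (simp add: add_mono)
  qed (rule plus_defined_carrier[OF that])
  have bound: "t \<le> v x" if "t \<in> ?D x" "v \<in> jordan_measures M"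
    "\<And>m x. m \<in> F \<Longrightarrow> x \<in> carrier M \<Longrightarrow> m x \<le> v x" for t x v
    using that d_least by (intro decomposition_sums_le[of v d t x] jordan_measures_signed) auto
  have bdd: "bdd_above (?D x)" for x
  proof (rule bdd_aboveI)
    fix t assume "t \<in> ?D x"
    then show "t \<le> u x" using bound[of t x u] u by blast
  qed
  \<comment> \<open>The one-term decomposition already contributes \<open>d x\<close>.\<close>
  have s_upper: "m x \<le> s x" if "m \<in> F" "x \<in> carrier M" for m x
    using d_upper[OF that] cSup_upper[OF decomposition_sums_nonempty[OF that(2), of d] bdd] that(2)
    by (simp add: s_def)
  have "s \<in> signed_measures M"
    unfolding s_def
    by (rule signed_measuresI, rule Sup_decomposition_sums_plus[of u d])
      (use u jordan_measures_signed d_least sub in auto)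
  \<comment> \<open>Some member of the non-empty family lies below \<open>s\<close>.\<close>
  then have "s \<in> jordan_measures M"
    using F s_upper jordan_measures_above by blast
  moreover have "s x \<le> v x" if "x \<in> carrier M" "v \<in> jordan_measures M"
    "\<And>m x. m \<in> F \<Longrightarrow> x \<in> carrier M \<Longrightarrow> m x \<le> v x" for x v
  proof -
    have "Sup (?D x) \<le> v x"
      using decomposition_sums_nonempty[OF that(1), of d] bound[of _ x v] that(2,3)
      by (intro cSup_least) auto
    then show ?thesis using that(1) by (simp add: s_def)
  qed
  ultimately have "is_lub (jordan_order M) s F"
    unfolding is_lub_jordan_iff[OF F(1)] using s_upper by blast
  then show ?thesis using bdd by (intro exI[of _ s]) (simp add: s_def)
qed

lemma jordan_lub_exists:
  assumes "F \<subseteq> jordan_measures M" "F \<noteq> {}" "Upper (jordan_order M) F \<noteq> {}"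
  shows "\<exists>s. is_lub (jordan_order M) s F"
  using jordan_lub[OF assms, of "\<lambda>x. SUP m\<in>F. m x"] by auto

lemma decomposition_sums_uminus:
  "decomposition_sums M (\<lambda>z. - f z) x = uminus ` decomposition_sums M f x"
proof -
  have "sum_list (map (\<lambda>z. - f z) xs) = - sum_list (map f xs)" for xs
    by (simp add: uminus_sum_list_map o_def)
  then show ?thesis unfolding decomposition_sums_def by auto
qed

text \<open>The negation \<open>N\<close> reverses the order, so the supremum of the negated family
  is negated back.\<close>

lemma jordan_glb:
  assumes F: "F \<subseteq> jordan_measures M" "F \<noteq> {}" "Lower (jordan_order M) F \<noteq> {}"
    and e: "\<forall>x\<in>carrier M. e x = (INF m\<in>F. m x)"
  shows "\<exists>s. is_glb (jordan_order M) s F \<and>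
    (\<forall>x\<in>carrier M. bdd_below (decomposition_sums M e x) \<and> s x = Inf (decomposition_sums M e x))"
proof -
  define N where "N m = (\<lambda>x\<in>carrier M. - m x)" for m :: "'a \<Rightarrow> real"
  have N: "N m \<in> jordan_measures M" if "m \<in> jordan_measures M" for m
    unfolding N_def by (rule jordan_measures_uminus[OF that])
  have N_app: "N m x = - m x" if "x \<in> carrier M" for m x using that by (simp add: N_def)
  have NF: "N ` F \<subseteq> jordan_measures M" using N F(1) by blast
  obtain u where u: "u \<in> jordan_measures M" "\<And>m x. m \<in> F \<Longrightarrow> x \<in> carrier M \<Longrightarrow> u x \<le> m x"
    using F by (fastforce simp: Lower_def)
  have "N u \<in> Upper (jordan_order M) (N ` F)"
    using u N by (auto simp: Upper_def N_app)
  then have up: "Upper (jordan_order M) (N ` F) \<noteq> {}" by blast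
  have ne: "N ` F \<noteq> {}" using F(2) by simp
  \<comment> \<open>A real infimum is by definition the negated supremum of the negated set.\<close>
  have neg: "\<forall>x\<in>carrier M. - e x = (SUP m\<in>N ` F. m x)"
    by (simp add: e Inf_real_def image_image N_app)
  obtain s where lub: "is_lub (jordan_order M) s (N ` F)"
    and s: "\<forall>x\<in>carrier M. bdd_above (decomposition_sums M (\<lambda>x. - e x) x) \<and>
      s x = Sup (decomposition_sums M (\<lambda>x. - e x) x)"
    using jordan_lub[OF NF ne up neg] by (elim exE conjE)
  note lub' = lub[unfolded is_lub_jordan_iff[OF NF]]
  have "u x \<le> N s x" if v: "u \<in> jordan_measures M" "\<forall>m\<in>F. \<forall>x\<in>carrier M. u x \<le> m x"
    and x: "x \<in> carrier M" for u x
  proof -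
    have "\<forall>m\<in>N ` F. \<forall>x\<in>carrier M. m x \<le> N u x" using v by (auto simp: N_app)
    then have "s x \<le> N u x" using lub' N[OF v(1)] x by blast
    then show ?thesis using x by (simp add: N_app)
  qed
  moreover have "N s x \<le> m x" if "m \<in> F" "x \<in> carrier M" for m x
  proof -
    have "N m x \<le> s x" using lub' that by blast
    then show ?thesis using that by (simp add: N_app)
  qed
  ultimately have "is_glb (jordan_order M) (N s) F"
    unfolding is_glb_jordan_iff[OF F(1)] using N lub' by blast
  then show ?thesis
    using s by (intro exI[of _ "N s"]) (simp add: N_app decomposition_sums_uminus Inf_real_def)
qed

section \<open>The ordered group of Jordan signed measures\<close>

lemma jordan_partial_order: "partial_order (jordan_order M)"
proof unfold_locales
  fix m n
  assume mn: "m \<in> carrier (jordan_order M)" "n \<in> carrier (jordan_order M)"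
    and le: "m \<sqsubseteq>\<^bsub>jordan_order M\<^esub> n" "n \<sqsubseteq>\<^bsub>jordan_order M\<^esub> m"
  \<comment> \<open>Equality on the carrier suffices because the functions are extensional.\<close>
  then have "m = n"
    by (intro signed_measures_ext) (auto simp: jordan_measures_signed intro: antisym)
  then show "m .=\<^bsub>jordan_order M\<^esub> n" by simp
qed (auto intro: order_trans)

lemma jordan_group_group: "group (jordan_group M)"
proof (rule groupI)
  fix m assume m: "m \<in> carrier (jordan_group M)"
  show "\<exists>n\<in>carrier (jordan_group M). n \<otimes>\<^bsub>jordan_group M\<^esub> m = \<one>\<^bsub>jordan_group M\<^esub>"
    using m jordan_measures_uminus by (intro bexI[of _ "\<lambda>x\<in>carrier M. - m x"]) auto
  show "\<one>\<^bsub>jordan_group M\<^esub> \<otimes>\<^bsub>jordan_group M\<^esub> m = m"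
    using m jordan_measures_add[OF measures_on_jordan[OF zero_measure], of m]
    by (auto intro!: signed_measures_ext jordan_measures_signed)
qed (auto simp: jordan_measures_add measures_on_jordan zero_measure algebra_simps)

text \<open>Any pair is bounded: the sum of the positive parts of two Jordan representations lies
  above both, the negated sum of the subtracted parts below both.\<close>

lemma jordan_lattice: "lattice (jordan_order M)"
proof -
  have "\<exists>s. is_lub (jordan_order M) s {m, n}"
    if mn: "m \<in> jordan_measures M" "n \<in> jordan_measures M" for m n
  proof -
    obtain m1 m2 where m: "m1 \<in> measures_on M" "m2 \<in> measures_on M"
      "\<And>x. x \<in> carrier M \<Longrightarrow> m x = m1 x - m2 x" using jordan_measuresE[OF mn(1)] by blast
    obtain n1 n2 where n: "n1 \<in> measures_on M" "n2 \<in> measures_on M"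
      "\<And>x. x \<in> carrier M \<Longrightarrow> n x = n1 x - n2 x" using jordan_measuresE[OF mn(2)] by blast
    have "(\<lambda>x\<in>carrier M. m1 x + n1 x) \<in> Upper (jordan_order M) {m, n}"
      using m n measures_on_jordan[OF measures_on_add[OF m(1) n(1)]]
      by (fastforce simp: Upper_def measures_on_def)
    then show ?thesis
      using jordan_lub_exists[of "{m, n}"] mn by blast
  qed
  moreover have "\<exists>s. is_glb (jordan_order M) s {m, n}"
    if mn: "m \<in> jordan_measures M" "n \<in> jordan_measures M" for m n
  proof -
    obtain m1 m2 where m: "m1 \<in> measures_on M" "m2 \<in> measures_on M"
      "\<And>x. x \<in> carrier M \<Longrightarrow> m x = m1 x - m2 x" using jordan_measuresE[OF mn(1)] by blast
    obtain n1 n2 where n: "n1 \<in> measures_on M" "n2 \<in> measures_on M"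
      "\<And>x. x \<in> carrier M \<Longrightarrow> n x = n1 x - n2 x" using jordan_measuresE[OF mn(2)] by blast
    have "(\<lambda>x\<in>carrier M. - (\<lambda>x\<in>carrier M. m2 x + n2 x) x) \<in> Lower (jordan_order M) {m, n}"
      using m n jordan_measures_uminus[OF measures_on_jordan[OF measures_on_add[OF m(2) n(2)]]]
      by (fastforce simp: Lower_def measures_on_def)
    then show ?thesis
      using jordan_glb[of "{m, n}" "\<lambda>x. INF m\<in>{m, n}. m x"] mn by auto
  qed
  ultimately show ?thesis
    using jordan_partial_order
    by (intro lattice.intro upper_semilattice.intro lower_semilattice.intro
        upper_semilattice_axioms.intro lower_semilattice_axioms.intro) simp_all
qed

lemma jordan_dedekind_complete: "dedekind_complete_l_group (jordan_group M) (jordan_order M)"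
proof -
  have "l_group (jordan_group M) (jordan_order M)"
    using jordan_group_group jordan_lattice
    by (auto simp: l_group_def l_group_axioms_def)
  moreover have "\<exists>s. is_lub (jordan_order M) s F"
    if "F \<subseteq> jordan_measures M" "F \<noteq> {}" "Upper (jordan_order M) F \<noteq> {}" for F
    by (rule jordan_lub_exists[OF that])
  ultimately show ?thesis
    by (auto simp: dedekind_complete_l_group_def dedekind_complete_l_group_axioms_def)
qed

end

theorem theorem6p2:
  fixes M :: "('a, 'b) emv_scheme"
  assumes "emv_algebra M"
  shows "dedekind_complete_l_group (jordan_group M) (jordan_order M) \<and>
    (\<forall>(I :: 'i set) (m :: 'i \<Rightarrow> 'a \<Rightarrow> real) (d :: 'a \<Rightarrow> real).
       I \<noteq> {} \<longrightarrow> m ` I \<subseteq> jordan_measures M \<longrightarrow> Upper (jordan_order M) (m ` I) \<noteq> {} \<longrightarrow>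
       (\<forall>x\<in>carrier M. d x = (SUP i\<in>I. m i x)) \<longrightarrow>
       (\<exists>s. is_lub (jordan_order M) s (m ` I) \<and>
         (\<forall>x\<in>carrier M. bdd_above (decomposition_sums M d x) \<and>
            s x = Sup (decomposition_sums M d x)))) \<and>
    (\<forall>(I :: 'i set) (m :: 'i \<Rightarrow> 'a \<Rightarrow> real) (e :: 'a \<Rightarrow> real).
       I \<noteq> {} \<longrightarrow> m ` I \<subseteq> jordan_measures M \<longrightarrow> Lower (jordan_order M) (m ` I) \<noteq> {} \<longrightarrow>
       (\<forall>x\<in>carrier M. e x = (INF i\<in>I. m i x)) \<longrightarrow>
       (\<exists>s. is_glb (jordan_order M) s (m ` I) \<and>
         (\<forall>x\<in>carrier M. bdd_below (decomposition_sums M e x) \<and>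
            s x = Inf (decomposition_sums M e x))))"
proof -
  interpret emv_algebra M by fact
  show ?thesis
  proof (intro conjI allI impI)
    show "dedekind_complete_l_group (jordan_group M) (jordan_order M)"
      by (rule jordan_dedekind_complete)
  next
    fix I :: "'i set" and m :: "'i \<Rightarrow> 'a \<Rightarrow> real" and d
    assume "I \<noteq> {}" "m ` I \<subseteq> jordan_measures M" "Upper (jordan_order M) (m ` I) \<noteq> {}"
      "\<forall>x\<in>carrier M. d x = (SUP i\<in>I. m i x)"
    then show "\<exists>s. is_lub (jordan_order M) s (m ` I) \<and>
        (\<forall>x\<in>carrier M. bdd_above (decomposition_sums M d x) \<and>
          s x = Sup (decomposition_sums M d x))"
      by (intro jordan_lub) (auto simp: image_image)
  next
    fix I :: "'i set" and m :: "'i \<Rightarrow> 'a \<Rightarrow> real" and e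
    assume "I \<noteq> {}" "m ` I \<subseteq> jordan_measures M" "Lower (jordan_order M) (m ` I) \<noteq> {}"
      "\<forall>x\<in>carrier M. e x = (INF i\<in>I. m i x)"
    then show "\<exists>s. is_glb (jordan_order M) s (m ` I) \<and>
        (\<forall>x\<in>carrier M. bdd_below (decomposition_sums M e x) \<and>
          s x = Inf (decomposition_sums M e x))"
      by (intro jordan_glb) (auto simp: image_image)
  qed
qed

end
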